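(* The implicit finite difference scheme (S) described in the context is unconditionally stable; that is, for all grid sizes $M_x,M_y\ge2$, $N\ge1$ (no restriction relating $\tau,h_x,h_y$) and all data $\varphi,\phi,f$, its solution satisfies $$\|U^N\|_1^2\le\|U^0\|_1^2+\sum_{l=1}^{p}\frac{a_lT^{2-\gamma_l}}{\Gamma(3-\gamma_l)}\|\phi\|_0^2+\frac{T}{\sum_{l=1}^{p}\frac{a_lT^{1-\gamma_l}}{\Gamma(2-\gamma_l)}+2b_1}\ \max_{1\le n\le N}\|f^{n-\frac12}\|_0^2 .$$
   Context: Parameters: integers $p,q,s\ge1$; reals $a_l>0$ ($1\le l\le p$), $b_1,b_2,b_3>0$, $c_m>0$ ($1\le m\le q$), $d_r>0$ ($1\le r\le s$); orders $1<\gamma_l<2$, $0<\alpha_m<1$, $0<\beta_r<1$; $T,L_x,L_y>0$, $\Omega=(0,L_x)\times(0,L_y)$. The scheme discretizes the problem $$\sum_{l}a_lD_t^{\gamma_l}u+b_1u_t+\sum_m c_mD_t^{\alpha_m}u+b_2u=b_3(u_{xx}+u_{yy})+\sum_r d_rD_t^{\beta_r}(u_{xx}+u_{yy})+f$$ on $\Omega\times(0,T]$ with Caputo time derivatives, $u(x,y,0)=\varphi$, $u_t(x,y,0)=\phi$, and $u=0$ on $\partial\Omega$. Grid: $h_x=L_x/M_x$, $h_y=L_y/M_y$, $\tau=T/N$, $x_i=ih_x$, $y_j=jh_y$, $t_n=n\tau$. $\mathcal V_h$ is the space of real grid functions $v=(v_{ij})_{0\le i\le M_x,0\le j\le M_y}$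 with $v_{0j}=v_{M_xj}=v_{i0}=v_{iM_y}=0$. Notation: $\nabla_tv^n_{ij}=(v^n_{ij}-v^{n-1}_{ij})/\tau$, $v^{n-\frac12}_{ij}=(v^n_{ij}+v^{n-1}_{ij})/2$, $\nabla_xv_{ij}=(v_{ij}-v_{i-1,j})/h_x$, $\nabla_yv_{ij}=(v_{ij}-v_{i,j-1})/h_y$, $\delta_x^2v_{ij}=(v_{i-1,j}-2v_{ij}+v_{i+1,j})/h_x^2$, $\delta_y^2v_{ij}=(v_{i,j-1}-2v_{ij}+v_{i,j+1})/h_y^2$, $f^n_{ij}=f(x_i,y_j,t_n)$, $\phi_{ij}=\phi(x_i,y_j)$, $\varphi_{ij}=\varphi(x_i,y_j)$. Norms: $\|v\|_0^2=h_xh_y\sum_{i=1}^{M_x-1}\sum_{j=1}^{M_y-1}v_{ij}^2$, $|v|_1^2=h_xh_y\sum_{i=1}^{M_x}\sum_{j=1}^{M_y}\big[(\nabla_xv_{ij})^2+(\nabla_yv_{ij})^2\big]$, $\|v\|_1^2=b_2\|v\|_0^2+b_3|v|_1^2$. Coefficients: $\mu_{1,l}=\tau^{1-\gamma_l}/\Gamma(3-\gamma_l)$, $\mu_{2,m}=\tau^{1-\alpha_m}/\Gamma(2-\alpha_m)$, $\mu_{3,r}=\tau^{1-\beta_r}/\Gamma(2-\beta_r)$. For $\gamma\in(1,2)$, $a_k^{(\gamma)}=(k+1)^{2-\gamma}-k^{2-\gamma}$, $k\ge0$. For $\alpha\in(0,1)$: $\tilde a_0^{(\alpha)}=(\tfrac12)^{1-\alpha}$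 and, for $k\ge1$, $\tilde a_k^{(\alpha)}=(k+\tfrac12)^{1-\alpha}-(k-\tfrac12)^{1-\alpha}$, $\tilde b_k^{(\alpha)}=\frac1{2-\alpha}[(k+\tfrac12)^{2-\alpha}-(k-\tfrac12)^{2-\alpha}]-\frac12[(k+\tfrac12)^{1-\alpha}+(k-\tfrac12)^{1-\alpha}]$; $c_0^{(1,\alpha)}=\tilde a_0^{(\alpha)}$, and for $n\ge2$: $c_0^{(n,\alpha)}=\tilde a_0^{(\alpha)}+\tilde b_1^{(\alpha)}$, $c_k^{(n,\alpha)}=\tilde a_k^{(\alpha)}+\tilde b_{k+1}^{(\alpha)}-\tilde b_k^{(\alpha)}$ ($1\le k\le n-2$), $c_{n-1}^{(n,\alpha)}=\tilde a_{n-1}^{(\alpha)}-\tilde b_{n-1}^{(\alpha)}$. Scheme (S): for $1\le n\le N$, $1\le i\le M_x-1$, $1\le j\le M_y-1$, $$\sum_{l=1}^{p}a_l\mu_{1,l}\Big[a_0^{(\gamma_l)}\nabla_tU_{ij}^{n}-\sum_{k=1}^{n-1}(a_{n-k-1}^{(\gamma_l)}-a_{n-k}^{(\gamma_l)})\nabla_tU_{ij}^{k}-a_{n-1}^{(\gamma_l)}\phi_{ij}\Big]+b_1\nabla_tU_{ij}^{n}+\sum_{m=1}^qc_m\mu_{2,m}\sum_{k=1}^n c_{n-k}^{(n,\alpha_m)}\nabla_tU_{ij}^k+b_2U_{ij}^{n-\frac12}$$ $$=b_3(\delta_x^2+\delta_y^2)U_{ij}^{n-\frac12}+\sum_{r=1}^sd_r\mu_{3,r}\sum_{k=1}^n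 c_{n-k}^{(n,\beta_r)}\nabla_t(\delta_x^2+\delta_y^2)U_{ij}^k+f_{ij}^{n-\frac12},$$ with $U^0_{ij}=\varphi_{ij}$ on the grid ($\varphi$ vanishing on $\partial\Omega$) and $U^n\in\mathcal V_h$ for $1\le n\le N$. *)

theory Defs
  imports "HOL-Analysis.Analysis"
begin

(* Only the values v i j with i \<le> M\<^sub>x and j \<le> M\<^sub>y of a grid function are ever used;
   a time-dependent grid function has the time level as its first argument. *)

type_synonym grid_fun = "nat \<Rightarrow> nat \<Rightarrow> real"

definition V_grid :: "nat \<Rightarrow> nat \<Rightarrow> grid_fun set" where
  "V_grid Mx My =
     {v. (\<forall>j\<le>My. v 0 j = 0 \<and> v Mx j = 0) \<and> (\<forall>i\<le>Mx. v i 0 = 0 \<and> v i My = 0)}"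

definition sample_xy :: "real \<Rightarrow> real \<Rightarrow> (real \<Rightarrow> real \<Rightarrow> real) \<Rightarrow> grid_fun" where
  "sample_xy hx hy g i j = g (real i * hx) (real j * hy)"

definition sample_xyt ::
  "real \<Rightarrow> real \<Rightarrow> real \<Rightarrow> (real \<Rightarrow> real \<Rightarrow> real \<Rightarrow> real) \<Rightarrow> nat \<Rightarrow> grid_fun" where
  "sample_xyt hx hy \<tau> g n i j = g (real i * hx) (real j * hy) (real n * \<tau>)"

(* The next two, and diff_x and diff_y below, are meant for indices \<ge> 1, because n - 1 is
   natural subtraction; mid_t v n is the average at the half level n - 1/2. *)

definition diff_t :: "real \<Rightarrow> (nat \<Rightarrow> grid_fun) \<Rightarrow> nat \<Rightarrow> grid_fun" where
  "diff_t \<tau> v n i j = (v n i j - v (n - 1) i j) / \<tau>"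

definition mid_t :: "(nat \<Rightarrow> grid_fun) \<Rightarrow> nat \<Rightarrow> grid_fun" where
  "mid_t v n i j = (v n i j + v (n - 1) i j) / 2"

definition diff_x :: "real \<Rightarrow> grid_fun \<Rightarrow> grid_fun" where
  "diff_x hx v i j = (v i j - v (i - 1) j) / hx"

definition diff_y :: "real \<Rightarrow> grid_fun \<Rightarrow> grid_fun" where
  "diff_y hy v i j = (v i j - v i (j - 1)) / hy"

definition diff2_x :: "real \<Rightarrow> grid_fun \<Rightarrow> grid_fun" where
  "diff2_x hx v i j = (v (i - 1) j - 2 * v i j + v (i + 1) j) / hx\<^sup>2"

definition diff2_y :: "real \<Rightarrow> grid_fun \<Rightarrow> grid_fun" where
  "diff2_y hy v i j = (v i (j - 1) - 2 * v i j + v i (j + 1)) / hy\<^sup>2"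

definition laplace_h :: "real \<Rightarrow> real \<Rightarrow> grid_fun \<Rightarrow> grid_fun" where
  "laplace_h hx hy v i j = diff2_x hx v i j + diff2_y hy v i j"

definition norm_0 :: "nat \<Rightarrow> nat \<Rightarrow> real \<Rightarrow> real \<Rightarrow> grid_fun \<Rightarrow> real" where
  "norm_0 Mx My hx hy v = sqrt (hx * hy * (\<Sum>i=1..Mx-1. \<Sum>j=1..My-1. (v i j)\<^sup>2))"

definition seminorm_1 :: "nat \<Rightarrow> nat \<Rightarrow> real \<Rightarrow> real \<Rightarrow> grid_fun \<Rightarrow> real" where
  "seminorm_1 Mx My hx hy v =
     sqrt (hx * hy * (\<Sum>i=1..Mx. \<Sum>j=1..My. (diff_x hx v i j)\<^sup>2 + (diff_y hy v i j)\<^sup>2))"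

definition norm_1 :: "real \<Rightarrow> real \<Rightarrow> nat \<Rightarrow> nat \<Rightarrow> real \<Rightarrow> real \<Rightarrow> grid_fun \<Rightarrow> real" where
  "norm_1 b2 b3 Mx My hx hy v =
     sqrt (b2 * (norm_0 Mx My hx hy v)\<^sup>2 + b3 * (seminorm_1 Mx My hx hy v)\<^sup>2)"

definition a_coeff :: "real \<Rightarrow> nat \<Rightarrow> real" where
  "a_coeff \<gamma> k = (real k + 1) powr (2 - \<gamma>) - real k powr (2 - \<gamma>)"

definition at_coeff :: "real \<Rightarrow> nat \<Rightarrow> real" where
  "at_coeff \<alpha> k =
     (if k = 0 then (1/2) powr (1 - \<alpha>)
      else (real k + 1/2) powr (1 - \<alpha>) - (real k - 1/2) powr (1 - \<alpha>))"

(* Used for k \<ge> 1 only. *)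
definition bt_coeff :: "real \<Rightarrow> nat \<Rightarrow> real" where
  "bt_coeff \<alpha> k =
     1 / (2 - \<alpha>) * ((real k + 1/2) powr (2 - \<alpha>) - (real k - 1/2) powr (2 - \<alpha>))
     - 1/2 * ((real k + 1/2) powr (1 - \<alpha>) + (real k - 1/2) powr (1 - \<alpha>))"

(* c_coeff \<alpha> n k is used for 0 \<le> k \<le> n - 1 only, so the last branch is k = n - 1 with n \<ge> 2. *)
definition c_coeff :: "real \<Rightarrow> nat \<Rightarrow> nat \<Rightarrow> real" where
  "c_coeff \<alpha> n k =
     (if n = 1 then at_coeff \<alpha> 0
      else if k = 0 then at_coeff \<alpha> 0 + bt_coeff \<alpha> 1
      else if k \<le> n - 2 then at_coeff \<alpha> k + bt_coeff \<alpha> (k + 1) - bt_coeff \<alpha> k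
      else at_coeff \<alpha> k - bt_coeff \<alpha> k)"

(* Discrete Caputo derivative of order \<gamma> in (1,2) at level n - 1/2; w is the initial velocity. *)
definition caputo_12 ::
  "real \<Rightarrow> real \<Rightarrow> grid_fun \<Rightarrow> (nat \<Rightarrow> grid_fun) \<Rightarrow> nat \<Rightarrow> grid_fun" where
  "caputo_12 \<gamma> \<tau> w v n i j =
     \<tau> powr (1 - \<gamma>) / Gamma (3 - \<gamma>) *
       (a_coeff \<gamma> 0 * diff_t \<tau> v n i j
        - (\<Sum>k=1..n-1. (a_coeff \<gamma> (n - k - 1) - a_coeff \<gamma> (n - k)) * diff_t \<tau> v k i j)
        - a_coeff \<gamma> (n - 1) * w i j)"

(* Discrete Caputo derivative of order \<alpha> in (0,1) at level n - 1/2. *)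
definition caputo_01 :: "real \<Rightarrow> real \<Rightarrow> (nat \<Rightarrow> grid_fun) \<Rightarrow> nat \<Rightarrow> grid_fun" where
  "caputo_01 \<alpha> \<tau> v n i j =
     \<tau> powr (1 - \<alpha>) / Gamma (2 - \<alpha>) *
       (\<Sum>k=1..n. c_coeff \<alpha> n (n - k) * diff_t \<tau> v k i j)"

end

theory Submission
  imports Defs
begin

text \<open>Energy method: multiply the scheme by the discrete velocity \<open>diff_t \<tau> U n\<close> and sum over space
  and time. The \<open>b2\<close> and \<open>b3\<close> terms telescope to the energy difference. The terms of order
  \<open>\<gamma> \<in> (1,2)\<close> are bounded below by a multiple of the squared velocities minus the contribution of
  the initial velocity, and the squared velocities absorb the source term by Young's inequality.

  The terms of order \<open>\<alpha>, \<beta> \<in> (0,1)\<close> are nonnegative. Put \<open>s k = at_coeff \<alpha> k - bt_coeff \<alpha> k\<close> and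
  \<open>b k = bt_coeff \<alpha> k\<close>. Off the diagonal, \<open>c_coeff \<alpha> n k\<close> is \<open>s (n - 1)\<close> for \<open>k = n - 1\<close> and
  \<open>s k + b (k + 1)\<close> otherwise. For \<open>k \<ge> 1\<close> the sequences \<open>s\<close> and \<open>b\<close> are nonnegative, nonincreasing and
  convex, being the integrals over \<open>[-1/2, 1/2]\<close> of \<open>1 + u\<close> and \<open>-u\<close> against the completely monotone
  function \<open>(1 - \<alpha>) (k + u) powr (-\<alpha>)\<close>. For small \<open>\<alpha>\<close> the diagonal entry is smaller than the next
  one, and what is needed there is \<open>4 - 3 * 3 powr (1 - \<alpha>) + 5 powr (1 - \<alpha>) \<ge> 0\<close>.\<close>

section \<open>Successive differences of negative powers\<close>

lemma powr_neg_antimono: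
  fixes a x y :: real
  assumes "a > 0" "0 < x" "x \<le> y"
  shows "y powr (-a) \<le> x powr (-a)"
  using assms by (intro powr_mono2') auto

text \<open>The derivative is \<open>-a\<close> times a first difference of the power with exponent
  \<open>-a-1\<close>, hence nonpositive. For \<open>y = x + 1\<close> this is discrete
  convexity.\<close>

lemma powr_neg_diff_antimono:
  fixes a x y :: real
  assumes a: "a > 0" and x: "0 < x" and xy: "x \<le> y"
  shows "y powr (-a) - (y + 1) powr (-a) \<le> x powr (-a) - (x + 1) powr (-a)"
proof (rule DERIV_nonpos_imp_nonincreasing[OF xy])
  fix z assume z: "x \<le> z" "z \<le> y"
  have "((\<lambda>z. z powr (-a) - (z + 1) powr (-a)) has_real_derivative
      (- a * (z powr (-a-1) - (z + 1) powr (-a-1)))) (at z)"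
    using z x by (auto intro!: derivative_eq_intros simp: right_diff_distrib)
  moreover have "(z + 1) powr (-a-1) \<le> z powr (-a-1)"
    using powr_neg_antimono[of "a+1" z "z+1"] z x a by simp
  ultimately show "\<exists>d. ((\<lambda>z. z powr (-a) - (z + 1) powr (-a)) has_real_derivative d) (at z) \<and> d \<le> 0"
    using a by (auto simp: mult_nonneg_nonneg intro!: exI)
qed

text \<open>One order higher: the sign of the derivative is the preceding lemma with
  \<open>a + 1\<close> for \<open>a\<close>. This serves the convexity of
  \<open>bt_coeff\<close>.\<close>

lemma powr_neg_diff2_antimono:
  fixes a x y :: real
  assumes a: "a > 0" and x: "0 < x" and xy: "x \<le> y"
  shows "y powr (-a) - 2 * (y + 1) powr (-a) + (y + 2) powr (-a)
       \<le> x powr (-a) - 2 * (x + 1) powr (-a) + (x + 2) powr (-a)"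
proof (rule DERIV_nonpos_imp_nonincreasing[OF xy])
  fix z assume z: "x \<le> z" "z \<le> y"
  let ?d = "- a * (z powr (-a-1) - 2 * (z + 1) powr (-a-1) + (z + 2) powr (-a-1))"
  have "((\<lambda>z. z powr (-a) - 2 * (z + 1) powr (-a) + (z + 2) powr (-a)) has_real_derivative ?d) (at z)"
    using z x by (auto intro!: derivative_eq_intros simp: right_diff_distrib distrib_left)
  moreover have "0 \<le> z powr (-a-1) - 2 * (z + 1) powr (-a-1) + (z + 2) powr (-a-1)"
  proof -
    have "-(a+1) = -a-1" "z+1+1 = z+2" by simp_all
    note powr_neg_diff_antimono[of "a+1" z "z+1", unfolded this]
    then show ?thesis using z x a by linarith
  qed
  ultimately show "\<exists>d. ((\<lambda>z. z powr (-a) - 2 * (z + 1) powr (-a) + (z + 2) powr (-a))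
      has_real_derivative d) (at z) \<and> d \<le> 0"
    using a by (intro exI[of _ ?d]) (auto simp: mult_nonneg_nonneg)
qed

section \<open>Integral representations and shape of \<open>bt_coeff\<close> and
  \<open>at_coeff - bt_coeff\<close>\<close>

text \<open>The weight \<open>-u\<close> has integral zero over the symmetric interval, so
  \<open>\<phi> 0\<close> may be subtracted from \<phi>; then \<open>-u\<close> and
  \<open>\<phi> u - \<phi> 0\<close> never have opposite signs.\<close>

lemma has_integral_first_moment_nonneg:
  fixes \<phi> :: "real \<Rightarrow> real"
  assumes int: "((\<lambda>u. - u * \<phi> u) has_integral I) {-1/2..1/2}"
    and mono: "\<And>u v. -1/2 \<le> u \<Longrightarrow> u \<le> v \<Longrightarrow> v \<le> 1/2 \<Longrightarrow> \<phi> v \<le> \<phi> u"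
  shows "0 \<le> I"
proof -
  have "((\<lambda>u::real. - u * \<phi> 0) has_integral
      ((\<lambda>u. - u\<^sup>2 / 2 * \<phi> 0) (1/2) - (\<lambda>u. - u\<^sup>2 / 2 * \<phi> 0) (-1/2))) {-1/2..1/2}"
    by (intro fundamental_theorem_of_calculus)
      (auto simp flip: has_real_derivative_iff_has_vector_derivative intro!: derivative_eq_intros)
  then have "((\<lambda>u::real. - u * \<phi> 0) has_integral 0) {-1/2..1/2}"
    by (simp add: power2_eq_square)
  from has_integral_diff[OF int this]
  have "((\<lambda>u. - u * \<phi> u - - u * \<phi> 0) has_integral I) {-1/2..1/2}" by simp
  then show ?thesis
  proof (rule has_integral_nonneg)
    fix u :: real assume u: "u \<in> {-1/2..1/2}"
    show "0 \<le> - u * \<phi> u - - u * \<phi> 0"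
    proof (cases "u \<ge> 0")
      case True
      then have "u * \<phi> u \<le> u * \<phi> 0" using mono[of 0 u] u by (intro mult_left_mono) auto
      then show ?thesis by simp
    next
      case False
      then have "u * \<phi> u \<le> u * \<phi> 0" using mono[of u 0] u by (intro mult_left_mono_neg) auto
      then show ?thesis by simp
    qed
  qed
qed

text \<open>Integration by parts: \<open>bt_coeff \<alpha> k\<close> is the exact integral of
  \<open>x powr (1 - \<alpha>)\<close> over the unit cell around \<open>k\<close> minus its
  trapezoidal value.\<close>

lemma bt_coeff_has_integral:
  assumes \<alpha>: "0 < \<alpha>" "\<alpha> < 1" and k: "k \<ge> 1"
  shows "((\<lambda>u. - u * ((1 - \<alpha>) * (real k + u) powr (-\<alpha>))) has_integral bt_coeff \<alpha> k) {-1/2..1/2}"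
proof -
  let ?G = "\<lambda>u. - u * (real k + u) powr (1 - \<alpha>) + (real k + u) powr (2 - \<alpha>) / (2 - \<alpha>)"
  have "((\<lambda>u. - u * ((1 - \<alpha>) * (real k + u) powr (-\<alpha>))) has_integral (?G (1/2) - ?G (-1/2))) {-1/2..1/2}"
  proof (intro fundamental_theorem_of_calculus)
    fix u :: real assume u: "u \<in> {-1/2..1/2}"
    have pos: "real k + u > 0" using u k by auto
    have d1: "((\<lambda>u. (real k + u) powr (2 - \<alpha>) / (2 - \<alpha>)) has_real_derivative
        (real k + u) powr (1 - \<alpha>)) (at u within {-1/2..1/2})"
      using pos \<alpha> by (auto intro!: derivative_eq_intros)
    have d2: "((\<lambda>u. - u * (real k + u) powr (1 - \<alpha>)) has_real_derivative
        - u * ((1 - \<alpha>) * (real k + u) powr (-\<alpha>)) - (real k + u) powr (1 - \<alpha>)) (at u within {-1/2..1/2})"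
      using pos \<alpha> by (auto intro!: derivative_eq_intros)
    have "(?G has_real_derivative (- u * ((1 - \<alpha>) * (real k + u) powr (-\<alpha>)))) (at u within {-1/2..1/2})"
      using DERIV_add[OF d2 d1] by simp
    then show "(?G has_vector_derivative (- u * ((1 - \<alpha>) * (real k + u) powr (-\<alpha>)))) (at u within {-1/2..1/2})"
      by (simp add: has_real_derivative_iff_has_vector_derivative)
  qed simp
  moreover have "?G (1/2) - ?G (-1/2) = bt_coeff \<alpha> k"
    unfolding bt_coeff_def by (simp add: add_divide_distrib diff_divide_distrib right_diff_distrib)
  ultimately show ?thesis by simp
qed

lemma at_coeff_has_integral:
  assumes \<alpha>: "0 < \<alpha>" "\<alpha> < 1" and k: "k \<ge> 1"
  shows "((\<lambda>u. (1 - \<alpha>) * (real k + u) powr (-\<alpha>)) has_integral at_coeff \<alpha> k) {-1/2..1/2}"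
proof -
  let ?G = "\<lambda>u. (real k + u) powr (1 - \<alpha>)"
  have "((\<lambda>u. (1 - \<alpha>) * (real k + u) powr (-\<alpha>)) has_integral (?G (1/2) - ?G (-1/2))) {-1/2..1/2}"
  proof (intro fundamental_theorem_of_calculus)
    fix u :: real assume u: "u \<in> {-1/2..1/2}"
    have pos: "real k + u > 0" using u k by auto
    have "(?G has_real_derivative ((1 - \<alpha>) * (real k + u) powr (-\<alpha>))) (at u within {-1/2..1/2})"
      using pos \<alpha> by (auto intro!: derivative_eq_intros)
    then show "(?G has_vector_derivative ((1 - \<alpha>) * (real k + u) powr (-\<alpha>))) (at u within {-1/2..1/2})"
      by (simp add: has_real_derivative_iff_has_vector_derivative)
  qed simp
  then show ?thesis using k by (simp add: at_coeff_def)
qed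

lemma at_minus_bt_coeff_has_integral:
  assumes \<alpha>: "0 < \<alpha>" "\<alpha> < 1" and k: "k \<ge> 1"
  shows "((\<lambda>u. (1 + u) * ((1 - \<alpha>) * (real k + u) powr (-\<alpha>)))
    has_integral (at_coeff \<alpha> k - bt_coeff \<alpha> k)) {-1/2..1/2}"
  using has_integral_diff[OF at_coeff_has_integral[OF assms] bt_coeff_has_integral[OF assms]]
  by (simp add: algebra_simps)

lemma bt_coeff_nonneg:
  assumes \<alpha>: "0 < \<alpha>" "\<alpha> < 1" and k: "k \<ge> 1"
  shows "0 \<le> bt_coeff \<alpha> k"
  using bt_coeff_has_integral[OF assms]
  by (rule has_integral_first_moment_nonneg)
    (use \<alpha> k in \<open>auto intro!: mult_left_mono powr_neg_antimono\<close>)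

text \<open>The difference of consecutive coefficients is again a first moment, now against a first
  difference of the power. Convexity repeats this with the second difference.\<close>

lemma bt_coeff_decreasing:
  assumes \<alpha>: "0 < \<alpha>" "\<alpha> < 1" and k: "k \<ge> 1"
  shows "bt_coeff \<alpha> (k + 1) \<le> bt_coeff \<alpha> k"
proof -
  have "((\<lambda>u. - u * ((1 - \<alpha>) * ((real k + u) powr (-\<alpha>) - (real k + u + 1) powr (-\<alpha>))))
      has_integral (bt_coeff \<alpha> k - bt_coeff \<alpha> (k + 1))) {-1/2..1/2}"
    using has_integral_diff[OF bt_coeff_has_integral[OF \<alpha> k] bt_coeff_has_integral[OF \<alpha>, of "k + 1"]]
    by (simp add: algebra_simps)
  then have "0 \<le> bt_coeff \<alpha> k - bt_coeff \<alpha> (k + 1)"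
    by (rule has_integral_first_moment_nonneg)
      (use \<alpha> k in \<open>auto intro!: mult_left_mono powr_neg_diff_antimono\<close>)
  then show ?thesis by simp
qed

lemma bt_coeff_convex:
  assumes \<alpha>: "0 < \<alpha>" "\<alpha> < 1" and k: "k \<ge> 1"
  shows "2 * bt_coeff \<alpha> (k + 1) \<le> bt_coeff \<alpha> k + bt_coeff \<alpha> (k + 2)"
proof -
  have "((\<lambda>u. - u * ((1 - \<alpha>) * ((real k + u) powr (-\<alpha>) - 2 * (real k + u + 1) powr (-\<alpha>)
        + (real k + u + 2) powr (-\<alpha>))))
      has_integral (bt_coeff \<alpha> k - 2 * bt_coeff \<alpha> (k + 1) + bt_coeff \<alpha> (k + 2))) {-1/2..1/2}"
    using has_integral_add[OF has_integral_diff[OF bt_coeff_has_integral[OF \<alpha> k]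
        has_integral_mult_right[OF bt_coeff_has_integral[OF \<alpha>, of "k + 1"], of 2]]
        bt_coeff_has_integral[OF \<alpha>, of "k + 2"]]
    by (simp add: algebra_simps)
  then have "0 \<le> bt_coeff \<alpha> k - 2 * bt_coeff \<alpha> (k + 1) + bt_coeff \<alpha> (k + 2)"
    by (rule has_integral_first_moment_nonneg)
      (use \<alpha> k in \<open>auto intro!: mult_left_mono powr_neg_diff2_antimono\<close>)
  then show ?thesis by simp
qed

text \<open>The weight \<open>1 + u\<close> is positive on the interval, so here and in the next two
  lemmas pointwise inequalities are enough.\<close>

lemma at_minus_bt_coeff_nonneg:
  assumes \<alpha>: "0 < \<alpha>" "\<alpha> < 1" and k: "k \<ge> 1"
  shows "0 \<le> at_coeff \<alpha> k - bt_coeff \<alpha> k"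
  using at_minus_bt_coeff_has_integral[OF assms]
  by (rule has_integral_nonneg) (use \<alpha> in auto)

lemma at_minus_bt_coeff_decreasing:
  assumes \<alpha>: "0 < \<alpha>" "\<alpha> < 1" and k: "k \<ge> 1"
  shows "at_coeff \<alpha> (k + 1) - bt_coeff \<alpha> (k + 1) \<le> at_coeff \<alpha> k - bt_coeff \<alpha> k"
proof (rule has_integral_le[OF at_minus_bt_coeff_has_integral[OF \<alpha>]
        at_minus_bt_coeff_has_integral[OF \<alpha> k]])
  fix u :: real assume "u \<in> {-1/2..1/2}"
  then show "(1 + u) * ((1 - \<alpha>) * (real (k + 1) + u) powr -\<alpha>)
      \<le> (1 + u) * ((1 - \<alpha>) * (real k + u) powr -\<alpha>)"
    using \<alpha> k by (intro mult_left_mono powr_neg_antimono) auto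
qed simp

lemma at_minus_bt_coeff_convex:
  assumes \<alpha>: "0 < \<alpha>" "\<alpha> < 1" and k: "k \<ge> 1"
  shows "2 * (at_coeff \<alpha> (k + 1) - bt_coeff \<alpha> (k + 1))
    \<le> (at_coeff \<alpha> k - bt_coeff \<alpha> k) + (at_coeff \<alpha> (k + 2) - bt_coeff \<alpha> (k + 2))"
proof (rule has_integral_le[OF has_integral_mult_right[OF at_minus_bt_coeff_has_integral[OF \<alpha>]]
        has_integral_add[OF at_minus_bt_coeff_has_integral[OF \<alpha> k] at_minus_bt_coeff_has_integral[OF \<alpha>]]])
  fix u :: real assume u: "u \<in> {-1/2..1/2}"
  let ?x = "real k + u"
  have "0 \<le> ?x powr -\<alpha> - 2 * (?x + 1) powr -\<alpha> + (?x + 2) powr -\<alpha>"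
    using powr_neg_diff_antimono[of \<alpha> ?x "?x + 1"] u \<alpha> k by (simp add: add.assoc)
  then have "0 \<le> (1 + u) * ((1 - \<alpha>) * (?x powr -\<alpha> - 2 * (?x + 1) powr -\<alpha> + (?x + 2) powr -\<alpha>))"
    using u \<alpha> by (intro mult_nonneg_nonneg) auto
  then show "2 * ((1 + u) * ((1 - \<alpha>) * (real (k + 1) + u) powr -\<alpha>))
      \<le> (1 + u) * ((1 - \<alpha>) * ?x powr -\<alpha>) + (1 + u) * ((1 - \<alpha>) * (real (k + 2) + u) powr -\<alpha>)"
    by (simp add: algebra_simps)
qed simp_all

section \<open>Diagonal inequalities and nonnegativity of triangular quadratic forms\<close>

lemma at_coeff_diagonal:
  assumes \<alpha>: "0 < \<alpha>" "\<alpha> < 1"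
  shows "2 * at_coeff \<alpha> 1 \<le> 2 * at_coeff \<alpha> 0 + at_coeff \<alpha> 2"
proof -
  define \<beta> where "\<beta> = 1 - \<alpha>"
  \<comment> \<open>After scaling by \<open>2 powr \<beta>\<close> and then by \<open>3 powr (-\<beta>)\<close>, the claim is about a function convex in \<open>\<alpha>\<close> that
    vanishes at \<open>0\<close>; its tangent there is increasing because \<open>(5/3) ^ 5 \<le> 3 ^ 4\<close>.\<close>
  have "(5/3) ^ 5 \<le> (3 :: real) ^ 4" by (simp add: power_divide)
  then have "ln ((5/3 :: real) ^ 5) \<le> ln (3 ^ 4)" by (subst ln_le_cancel_iff) auto
  then have ln: "5 * ln (5/3 :: real) \<le> 4 * ln 3" using ln_realpow[of "5/3" 5] ln_realpow[of 3 4] by simp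
  have "1 + \<alpha> * ln 3 \<le> 3 powr \<alpha>"
    using exp_ge_add_one_self[of "\<alpha> * ln 3"] by (simp add: powr_def)
  moreover have "1 - \<alpha> * ln (5/3) \<le> (5/3) powr (-\<alpha>)"
    using exp_ge_add_one_self[of "-\<alpha> * ln (5/3)"] by (simp add: powr_def)
  moreover have "0 \<le> \<alpha> * (4 * ln 3 - 5 * ln (5/3))" using ln \<alpha> by (intro mult_nonneg_nonneg) auto
  ultimately have key: "9 \<le> 4 * 3 powr \<alpha> + 5 * (5/3) powr (-\<alpha>)"
    by (simp add: algebra_simps)
  have "9 * 3 powr (-\<alpha>) \<le> (4 * 3 powr \<alpha> + 5 * (5/3) powr (-\<alpha>)) * 3 powr (-\<alpha>)"
    using key by (intro mult_right_mono) auto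
  also have "\<dots> = 4 + 5 * 5 powr (-\<alpha>)"
    by (simp add: distrib_right powr_divide powr_minus field_simps)
  finally have "3 * 3 powr \<beta> \<le> 4 + 5 powr \<beta>"
    by (simp add: \<beta>_def powr_diff powr_minus field_simps)
  then have "3 * 3 powr \<beta> * (1/2) powr \<beta> \<le> (4 + 5 powr \<beta>) * (1/2) powr \<beta>"
    by (intro mult_right_mono) auto
  then have "3 * (3/2) powr \<beta> \<le> 4 * (1/2) powr \<beta> + (5/2) powr \<beta>"
    by (simp add: distrib_right mult.assoc flip: powr_mult)
  then show ?thesis by (simp add: at_coeff_def \<beta>_def)
qed

text \<open>Dividing by \<open>(1/2) powr (1 - \<alpha>)\<close> reduces this to
  \<open>3 powr (1 - \<alpha>) \<le> 3\<close>.\<close>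

lemma at_coeff_1_le:
  assumes \<alpha>: "0 < \<alpha>" "\<alpha> < 1"
  shows "at_coeff \<alpha> 1 \<le> 2 * at_coeff \<alpha> 0"
proof -
  have "(3/2 :: real) powr (1 - \<alpha>) = 3 powr (1 - \<alpha>) * (1/2) powr (1 - \<alpha>)"
    by (simp flip: powr_mult)
  also have "\<dots> \<le> 3 powr 1 * (1/2) powr (1 - \<alpha>)"
    using \<alpha> by (intro mult_right_mono powr_mono) auto
  finally show ?thesis by (simp add: at_coeff_def)
qed

text \<open>Summation by parts in both indices writes twice the form as a combination of squares of sums of
  \<open>v\<close> over intervals; the hypotheses make the weights nonnegative.\<close>

lemma triangular_form_nonneg:
  fixes A :: "nat \<Rightarrow> nat \<Rightarrow> real" and v :: "nat \<Rightarrow> real"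
  assumes A0: "\<And>n. A n 0 = 0"
    and mono: "\<And>n k. 1 \<le> k \<Longrightarrow> k < n \<Longrightarrow> A n (k - 1) \<le> A n k"
    and mono_diag: "\<And>n. 1 \<le> n \<Longrightarrow> A n (n - 1) \<le> 2 * A n n"
    and conv: "\<And>n k. 1 \<le> k \<Longrightarrow> k < n \<Longrightarrow>
      A (n + 1) k - A (n + 1) (k - 1) \<le> A n k - A n (k - 1)"
    and conv_diag: "\<And>n. 1 \<le> n \<Longrightarrow> A (n + 1) n - A (n + 1) (n - 1) \<le> 2 * A n n - A n (n - 1)"
  shows "0 \<le> (\<Sum>n=1..N. v n * (\<Sum>k=1..n. A n k * v k))"
proof -
  define V where "V n k = (\<Sum>m=k..n. v m)" for n k
  define D where "D n k = A n k - A n (k - 1)" for n k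
  \<comment> \<open>In twice row \<open>n\<close> of the form, the square of \<open>V n k\<close>
    has weight \<open>D n k\<close>. The leftover multiples of the square of \<open>v n\<close> add
    up to \<open>A n n\<close>, and since \<open>V n n = v n\<close> they join the diagonal
    weight.\<close>
  define E where "E n k = (if k = n then A n n else 0) + D n k" for n k
  have abel: "(\<Sum>k=1..n. A n k * v k) = (\<Sum>k=1..n. D n k * V n k)" for n
  proof -
    \<comment> \<open>The boundary term of the partial sum disappears at \<open>m = n\<close>, where
      \<open>V n (n + 1)\<close> is an empty sum.\<close>
    have "(\<Sum>k=1..m. A n k * v k) + A n m * V n (m + 1) = (\<Sum>k=1..m. D n k * V n k)" if "m \<le> n" for m
      using that
    proof (induction m)
      case (Suc m)
      have "V n (Suc m) = v (Suc m) + V n (Suc m + 1)"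
        using Suc.prems by (simp add: V_def sum.atLeast_Suc_atMost)
      then show ?case using Suc by (simp add: D_def algebra_simps)
    qed (simp add: A0)
    from this[of n] show ?thesis by (simp add: V_def)
  qed
  have E_nonneg: "0 \<le> E n k" if "1 \<le> k" "k \<le> n" for n k
    using mono[of k n] mono_diag[of n] that by (auto simp: E_def D_def)
  \<comment> \<open>Row \<open>n + 1\<close> takes away the square of \<open>V n k\<close> with
    weight \<open>D (n + 1) k\<close>; row \<open>n\<close> has supplied at least that much.\<close>
  have E_ge: "D (n + 1) k \<le> E n k" if "1 \<le> k" "k \<le> n" for n k
    using conv[of k n] conv_diag[of n] that by (auto simp: E_def D_def)
  have "(\<Sum>k=1..N. E N k * (V N k)\<^sup>2) \<le> 2 * (\<Sum>n=1..N. v n * (\<Sum>k=1..n. A n k * v k))"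
  proof (induction N)
    case (Suc N)
    have V_Suc: "V (Suc N) k = V N k + v (Suc N)" if "k \<le> N" for k
      using that by (simp add: V_def)
    have V_diag: "V (Suc N) (Suc N) = v (Suc N)" by (simp add: V_def)
    have "(\<Sum>k=1..Suc N. E (Suc N) k * (V (Suc N) k)\<^sup>2)
        = (\<Sum>k=1..N. D (Suc N) k * (V (Suc N) k)\<^sup>2)
          + (A (Suc N) (Suc N) + D (Suc N) (Suc N)) * (v (Suc N))\<^sup>2"
      by (simp add: E_def V_diag)
    moreover have "2 * (v (Suc N) * (\<Sum>k=1..Suc N. A (Suc N) k * v k))
        = (\<Sum>k=1..N. D (Suc N) k * ((V (Suc N) k)\<^sup>2 - (V N k)\<^sup>2 + (v (Suc N))\<^sup>2))
          + 2 * D (Suc N) (Suc N) * (v (Suc N))\<^sup>2"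
    proof -
      have *: "2 * (v (Suc N) * V (Suc N) k) = (V (Suc N) k)\<^sup>2 - (V N k)\<^sup>2 + (v (Suc N))\<^sup>2" if "k \<le> N" for k
        by (simp add: V_Suc[OF that] power2_eq_square algebra_simps)
      have "2 * (v (Suc N) * (\<Sum>k=1..Suc N. A (Suc N) k * v k))
          = (\<Sum>k=1..N. D (Suc N) k * (2 * (v (Suc N) * V (Suc N) k)))
            + 2 * D (Suc N) (Suc N) * (v (Suc N))\<^sup>2"
        unfolding abel by (simp add: V_diag power2_eq_square sum_distrib_left algebra_simps)
      also have "(\<Sum>k=1..N. D (Suc N) k * (2 * (v (Suc N) * V (Suc N) k)))
          = (\<Sum>k=1..N. D (Suc N) k * ((V (Suc N) k)\<^sup>2 - (V N k)\<^sup>2 + (v (Suc N))\<^sup>2))"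
        by (intro sum.cong) (auto simp: *)
      finally show ?thesis .
    qed
    moreover have "(\<Sum>k=1..N. D (Suc N) k) + D (Suc N) (Suc N) = A (Suc N) (Suc N)"
    proof -
      have "(\<Sum>k=1..m. D n k) = A n m" for m n
        by (induction m) (auto simp: A0 D_def)
      from this[where n="Suc N" and m="Suc N"] show ?thesis by simp
    qed
    then have "(\<Sum>k=1..N. D (Suc N) k * (v (Suc N))\<^sup>2)
        = (A (Suc N) (Suc N) - D (Suc N) (Suc N)) * (v (Suc N))\<^sup>2"
      by (simp flip: sum_distrib_right)
    moreover have "(\<Sum>k=1..N. D (Suc N) k * (V N k)\<^sup>2) \<le> (\<Sum>k=1..N. E N k * (V N k)\<^sup>2)"
      using E_ge[of _ N] by (intro sum_mono mult_right_mono) auto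
    ultimately show ?case using Suc.IH
      by (simp add: algebra_simps sum.distrib sum_subtractf)
  qed simp
  moreover have "0 \<le> (\<Sum>k=1..N. E N k * (V N k)\<^sup>2)"
    using E_nonneg by (intro sum_nonneg mult_nonneg_nonneg) auto
  ultimately show ?thesis by simp
qed

text \<open>As a matrix with row \<open>n\<close> and column \<open>k\<close>, the coefficients
  depend only on \<open>n - k\<close>, except in column 1: there they are \<open>s (n - 1)\<close>
  for \<open>n \<ge> 2\<close> and \<open>at_coeff \<alpha> 0\<close> for \<open>n = 1\<close>.
  Hence the case splits near that column.\<close>

lemma c_coeff_form_nonneg:
  assumes \<alpha>: "0 < \<alpha>" "\<alpha> < 1"
  shows "0 \<le> (\<Sum>n=1..N. v n * (\<Sum>k=1..n. c_coeff \<alpha> n (n - k) * v k))"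
proof -
  define b where "b k = bt_coeff \<alpha> k" for k
  define s where "s k = at_coeff \<alpha> k - bt_coeff \<alpha> k" for k
  define g where "g k = (if k = 0 then at_coeff \<alpha> 0 + b 1 else s k + b (k + 1))" for k
  define A where "A n k = (if k = 0 then 0 else c_coeff \<alpha> n (n - k))" for n k
  note b = bt_coeff_nonneg[OF \<alpha>, folded b_def] bt_coeff_decreasing[OF \<alpha>, folded b_def]
    bt_coeff_convex[OF \<alpha>, folded b_def]
  note s = at_minus_bt_coeff_nonneg[OF \<alpha>, folded s_def]
    at_minus_bt_coeff_decreasing[OF \<alpha>, folded s_def] at_minus_bt_coeff_convex[OF \<alpha>, folded s_def]
  have diag: "2 * s 1 + 2 * b 1 \<le> 2 * at_coeff \<alpha> 0 + s 2 + b 2"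
    using at_coeff_diagonal[OF \<alpha>] by (simp add: s_def b_def)
  have first: "s 1 \<le> 2 * at_coeff \<alpha> 0"
    using at_coeff_1_le[OF \<alpha>] b(1)[of 1] by (simp add: s_def b_def)
  have num: "(1::nat) + 1 = 2" "(2::nat) + 1 = 3" "(1::nat) + 2 = 3" by simp_all
  have b12: "b 2 \<le> b 1" "b 3 \<le> b 2" "0 \<le> b 3"
    using b(2)[of 1, unfolded num] b(2)[of 2, unfolded num] b(1)[of 3] by simp_all
  have A_col0: "A n 0 = 0" for n by (simp add: A_def)
  have A_11: "A 1 1 = at_coeff \<alpha> 0" by (simp add: A_def c_coeff_def)
  have A_col1: "A n (Suc 0) = s (n - 1)" if "n \<ge> 2" for n
    using that by (auto simp: A_def c_coeff_def s_def)
  have A_col: "A n k = g (n - k)" if "2 \<le> k" "k \<le> n" for n k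
    using that by (auto simp: A_def c_coeff_def g_def s_def b_def)
  have g_dec: "g (k + 1) \<le> g k" if "k \<ge> 1" for k
    using s(2)[of k] b(2)[of "k + 1"] that by (simp add: g_def)
  have g_conv: "2 * g (k + 1) \<le> g k + g (k + 2)" if "k \<ge> 1" for k
    using s(3)[of k] b(3)[of "k + 1"] that by (simp add: g_def)
  have g_vals: "g 0 = at_coeff \<alpha> 0 + b 1" "g 1 = s 1 + b 2" "g 2 = s 2 + b 3"
    unfolding g_def num by simp_all
  \<comment> \<open>Beyond \<open>diag\<close> this takes
    \<open>3 * b 2 \<le> 4 * b 1 + b 3\<close>, true because \<open>b\<close> is nonnegative and
    nonincreasing.\<close>
  have g_conv0: "2 * g 1 \<le> 2 * g 0 + g 2"
    using diag b12 g_vals by linarith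
  have g_0: "g 1 \<le> 2 * g 0" using g_conv0 g_dec[of 1, unfolded num] by simp
  have g_s: "s (k + 1) \<le> g k" if "k \<ge> 1" for k
    using s(2)[of k] b(1)[of "k + 1"] that by (simp add: g_def)
  have "0 \<le> (\<Sum>n=1..N. v n * (\<Sum>k=1..n. A n k * v k))"
  proof (rule triangular_form_nonneg)
    show "A n 0 = 0" for n by (rule A_col0)
  next
    fix n k :: nat assume kn: "1 \<le> k" "k < n"
    \<comment> \<open>The columns compared are 0 and 1, then 1 and 2, and from \<open>k = 3\<close>
      on only columns that depend on \<open>n - k\<close>.\<close>
    consider "k = 1" | "k = 2" | "k \<ge> 3" using kn by linarith
    then show "A n (k - 1) \<le> A n k"
    proof cases
      case 1 then show ?thesis using kn s(1)[of "n - 1"] A_col1[of n] by (simp add: A_col0)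
    next
      case 2
      then obtain m where "n = m + 2" "m \<ge> 1" using kn
        by (metis Suc_leI add.commute le_add_diff_inverse less_imp_le_nat zero_less_diff One_nat_def)
      then show ?thesis using 2 g_s[of m] by (simp add: A_col A_col1)
    next
      case 3 then show ?thesis using kn g_dec[of "n - k"] by (simp add: A_col Suc_diff_le)
    qed
  next
    fix n :: nat assume n: "1 \<le> n"
    consider "n = 1" | "n = 2" | "n \<ge> 3" using n by linarith
    then show "A n (n - 1) \<le> 2 * A n n"
    proof cases
      case 1 then show ?thesis using A_11 by (simp add: A_col0 at_coeff_def)
    next
      case 2 then show ?thesis using first b12 by (simp add: A_col A_col1 g_def)
    next
      case 3 then show ?thesis using g_0 by (simp add: A_col)
    qed
  next
    fix n k :: nat assume kn: "1 \<le> k" "k < n"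
    consider "k = 1" | "k = 2" | "k \<ge> 3" using kn by linarith
    then show "A (n + 1) k - A (n + 1) (k - 1) \<le> A n k - A n (k - 1)"
    proof cases
      case 1 then show ?thesis using kn s(2)[of "n - 1"] by (simp add: A_col0 A_col1)
    next
      case 2
      then obtain m where "n = m + 2" "m \<ge> 1" using kn
        by (metis Suc_leI add.commute le_add_diff_inverse less_imp_le_nat zero_less_diff One_nat_def)
      then show ?thesis using 2 s(3)[of m] b(2)[of "m + 1"]
        by (simp add: A_col A_col1 g_def)
    next
      case 3
      then obtain m where "n = m + k" "m \<ge> 1" using kn
        by (metis Suc_leI add.commute le_add_diff_inverse less_imp_le_nat zero_less_diff One_nat_def)
      then show ?thesis using 3 g_conv[of m] by (simp add: A_col)
    qed
  next
    fix n :: nat assume n: "1 \<le> n"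
    \<comment> \<open>For \<open>n = 1\<close> the claim is \<open>first\<close>; for
      \<open>n = 2\<close> it follows from \<open>diag\<close> and \<open>b12\<close>; from
      \<open>n = 3\<close> on it is \<open>g_conv0\<close>.\<close>
    consider "n = 1" | "n = 2" | "n \<ge> 3" using n by linarith
    then show "A (n + 1) n - A (n + 1) (n - 1) \<le> 2 * A n n - A n (n - 1)"
    proof cases
      case 1 then show ?thesis using first A_11 by (simp add: A_col0 A_col1)
    next
      case 2
      have "A 3 2 = g 1" "A 3 1 = s 2" "A 2 2 = g 0" "A 2 1 = s 1"
        using A_col[of 2 3] A_col[of 2 2] A_col1[of 3] A_col1[of 2] by simp_all
      then show ?thesis using 2 diag b12 by (simp add: g_vals[unfolded One_nat_def])
    next
      case 3 then show ?thesis using g_conv0 by (simp add: A_col)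
    qed
  qed
  also have "(\<Sum>n=1..N. v n * (\<Sum>k=1..n. A n k * v k))
      = (\<Sum>n=1..N. v n * (\<Sum>k=1..n. c_coeff \<alpha> n (n - k) * v k))"
    by (intro sum.cong arg_cong2[where f="(*)"] refl) (auto simp: A_def)
  finally show ?thesis .
qed

section \<open>Weights of order in (1,2) and their quadratic form\<close>

text \<open>The intermediate point is interior, so \<open>k = 0\<close> is covered although the
  power function has no finite slope at 0.\<close>

lemma a_coeff_MVT:
  assumes \<gamma>: "1 < \<gamma>" "\<gamma> < 2"
  obtains z where "real k < z" "z < real k + 1" "a_coeff \<gamma> k = (2 - \<gamma>) * z powr (1 - \<gamma>)"
proof -
  have "\<exists>l z. real k < z \<and> z < real k + 1 \<and> ((\<lambda>x. x powr (2 - \<gamma>)) has_real_derivative l) (at z) \<and>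
      (real k + 1) powr (2 - \<gamma>) - real k powr (2 - \<gamma>) = (real k + 1 - real k) * l"
  proof (rule MVT)
    show "continuous_on {real k..real k + 1} (\<lambda>x. x powr (2 - \<gamma>))"
      using \<gamma> by (intro continuous_on_powr') (auto intro!: continuous_intros)
    fix x assume "real k < x" "x < real k + 1"
    then have "((\<lambda>x. x powr (2 - \<gamma>)) has_real_derivative (2 - \<gamma>) * x powr (2 - \<gamma> - 1)) (at x)"
      by (intro has_real_derivative_powr) auto
    then show "(\<lambda>x. x powr (2 - \<gamma>)) differentiable (at x)"
      using real_differentiable_def by blast
  qed simp
  then obtain l z where z: "real k < z" "z < real k + 1"
    "((\<lambda>x. x powr (2 - \<gamma>)) has_real_derivative l) (at z)" "a_coeff \<gamma> k = l"
    by (auto simp: a_coeff_def)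
  moreover have "((\<lambda>x. x powr (2 - \<gamma>)) has_real_derivative (2 - \<gamma>) * z powr (2 - \<gamma> - 1)) (at z)"
    using z by (intro has_real_derivative_powr) auto
  ultimately have "l = (2 - \<gamma>) * z powr (1 - \<gamma>)"
    using DERIV_unique by fastforce
  with z show thesis using that by blast
qed

lemma a_coeff_decreasing:
  assumes \<gamma>: "1 < \<gamma>" "\<gamma> < 2"
  shows "a_coeff \<gamma> (Suc k) \<le> a_coeff \<gamma> k"
proof -
  obtain z where z: "real k < z" "z < real k + 1" "a_coeff \<gamma> k = (2 - \<gamma>) * z powr (1 - \<gamma>)"
    using a_coeff_MVT[OF \<gamma>] .
  obtain z' where z': "real (Suc k) < z'" "z' < real (Suc k) + 1"
    "a_coeff \<gamma> (Suc k) = (2 - \<gamma>) * z' powr (1 - \<gamma>)"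
    using a_coeff_MVT[OF \<gamma>] .
  have "z' powr (1 - \<gamma>) \<le> z powr (1 - \<gamma>)"
    using z z' \<gamma> by (intro powr_mono2') auto
  then show ?thesis using z z' \<gamma> by simp
qed

text \<open>The intermediate point lies below \<open>N\<close> and the derivative decreases.
  Uniformity in \<open>k\<close> later leaves one constant in front of all squared
  velocities.\<close>

lemma a_coeff_lower_bound:
  assumes \<gamma>: "1 < \<gamma>" "\<gamma> < 2" and k: "k < N"
  shows "(2 - \<gamma>) * real N powr (1 - \<gamma>) \<le> a_coeff \<gamma> k"
proof -
  obtain z where z: "real k < z" "z < real k + 1" "a_coeff \<gamma> k = (2 - \<gamma>) * z powr (1 - \<gamma>)"
    using a_coeff_MVT[OF \<gamma>] .
  have "real N powr (1 - \<gamma>) \<le> z powr (1 - \<gamma>)"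
    using z k \<gamma> by (intro powr_mono2') auto
  then show ?thesis using z \<gamma> by simp
qed

lemma a_coeff_nonneg:
  assumes \<gamma>: "1 < \<gamma>" "\<gamma> < 2"
  shows "0 \<le> a_coeff \<gamma> k"
  by (rule order_trans[OF _ a_coeff_lower_bound[OF \<gamma> lessI]]) (use \<gamma> in auto)

lemma sum_a_coeff:
  assumes \<gamma>: "1 < \<gamma>" "\<gamma> < 2"
  shows "(\<Sum>n=1..N. a_coeff \<gamma> (n - 1)) = real N powr (2 - \<gamma>)"
  using \<gamma> by (induction N) (auto simp: a_coeff_def add.commute)

text \<open>Induction on the last level. Young's inequality bounds the cross terms by
  \<open>(a 0 - a N) * x\<^sup>2\<close> from the history and \<open>a N * x\<^sup>2\<close> from
  \<open>w\<close>, together half of the available \<open>2 * a 0 * x\<^sup>2\<close>. The older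
  squares it costs lower their weights from \<open>a (N - k)\<close> to
  \<open>a (Suc N - k)\<close>.\<close>

lemma L1_form_lower_bound:
  fixes a :: "nat \<Rightarrow> real" and v :: "nat \<Rightarrow> real" and w :: real
  assumes dec: "\<And>k. a (Suc k) \<le> a k" and nonneg: "\<And>k. 0 \<le> a k"
  shows "(\<Sum>n=1..N. a (N - n) * (v n)\<^sup>2) - (\<Sum>n=1..N. a (n - 1)) * w\<^sup>2
    \<le> 2 * (\<Sum>n=1..N. v n * (a 0 * v n - (\<Sum>k=1..n-1. (a (n - k - 1) - a (n - k)) * v k) - a (n - 1) * w))"
proof (induction N)
  case (Suc N)
  define x where "x = v (Suc N)"
  define \<delta> where "\<delta> k = a (N - k) - a (Suc N - k)" for k
  have \<delta>: "0 \<le> \<delta> k" if "k \<le> N" for k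
    using dec[of "N - k"] that by (simp add: \<delta>_def Suc_diff_le)
  have young: "2 * (x * y) \<le> x\<^sup>2 + y\<^sup>2" for y
    using sum_squares_bound[of x y] by simp
  have "(\<Sum>k=1..m. a (N - k) - a (Suc N - k)) = a (N - m) - a N" if "m \<le> N" for m
    using that by (induction m) (auto simp: Suc_diff_le Suc_diff_Suc)
  from this[of N] have tel: "(\<Sum>k=1..N. \<delta> k) = a 0 - a N" by (simp add: \<delta>_def)
  have "2 * (x * (\<Sum>k=1..N. \<delta> k * v k)) = (\<Sum>k=1..N. \<delta> k * (2 * (x * v k)))"
    by (simp add: sum_distrib_left algebra_simps)
  also have "\<dots> \<le> (\<Sum>k=1..N. \<delta> k * (x\<^sup>2 + (v k)\<^sup>2))"
    using \<delta> young by (intro sum_mono mult_left_mono) auto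
  also have "\<dots> = (a 0 - a N) * x\<^sup>2 + (\<Sum>k=1..N. \<delta> k * (v k)\<^sup>2)"
    by (simp add: distrib_left sum.distrib tel[unfolded One_nat_def] flip: sum_distrib_right)
  finally have 1: "2 * (x * (\<Sum>k=1..N. \<delta> k * v k)) \<le> (a 0 - a N) * x\<^sup>2 + (\<Sum>k=1..N. \<delta> k * (v k)\<^sup>2)" .
  have 2: "a N * (2 * (x * w)) \<le> a N * (x\<^sup>2 + w\<^sup>2)"
    using young nonneg by (intro mult_left_mono) auto
  have 3: "(\<Sum>k=1..N. \<delta> k * (v k)\<^sup>2)
      = (\<Sum>k=1..N. a (N - k) * (v k)\<^sup>2) - (\<Sum>k=1..N. a (Suc N - k) * (v k)\<^sup>2)"
    by (simp add: \<delta>_def left_diff_distrib sum_subtractf)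
  have 4: "(\<Sum>k=1..Suc N - 1. (a (Suc N - k - 1) - a (Suc N - k)) * v k) = (\<Sum>k=1..N. \<delta> k * v k)"
    by (simp add: \<delta>_def)
  show ?case
    using Suc.IH 1 2 3
    by (simp only: 4 sum.cl_ivl_Suc x_def[symmetric])
      (simp add: algebra_simps power2_eq_square)
qed simp

section \<open>Discrete inner products and summation by parts in space\<close>

text \<open>The cell area \<open>hx * hy\<close> is left out here and in \<open>inner_1\<close>: it
  is a common factor of the energy inequality and returns with the norms.\<close>

definition inner_0 :: "nat \<Rightarrow> nat \<Rightarrow> grid_fun \<Rightarrow> grid_fun \<Rightarrow> real" where
  "inner_0 Mx My v w = (\<Sum>i=1..Mx-1. \<Sum>j=1..My-1. v i j * w i j)"

definition inner_1 :: "nat \<Rightarrow> nat \<Rightarrow> real \<Rightarrow> real \<Rightarrow> grid_fun \<Rightarrow> grid_fun \<Rightarrow> real" where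
  "inner_1 Mx My hx hy v w =
     (\<Sum>i=1..Mx. \<Sum>j=1..My. diff_x hx v i j * diff_x hx w i j + diff_y hy v i j * diff_y hy w i j)"

lemma norm_0_squared:
  assumes "hx > 0" "hy > 0"
  shows "(norm_0 Mx My hx hy v)\<^sup>2 = hx * hy * inner_0 Mx My v v"
proof -
  have "0 \<le> hx * hy * inner_0 Mx My v v"
    using assms by (simp add: inner_0_def sum_nonneg)
  then show ?thesis by (simp add: norm_0_def inner_0_def power2_eq_square)
qed

lemma norm_1_squared:
  assumes "hx > 0" "hy > 0" "b2 > 0" "b3 > 0"
  shows "(norm_1 b2 b3 Mx My hx hy v)\<^sup>2
    = hx * hy * (b2 * inner_0 Mx My v v + b3 * inner_1 Mx My hx hy v v)"
proof -
  have nonneg: "0 \<le> inner_0 Mx My v v" "0 \<le> inner_1 Mx My hx hy v v"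
    by (auto simp: inner_0_def inner_1_def intro!: sum_nonneg)
  then have "(seminorm_1 Mx My hx hy v)\<^sup>2 = hx * hy * inner_1 Mx My hx hy v v"
    using assms by (simp add: seminorm_1_def inner_1_def power2_eq_square)
  moreover have "0 \<le> b2 * (norm_0 Mx My hx hy v)\<^sup>2 + b3 * (seminorm_1 Mx My hx hy v)\<^sup>2"
    using assms by simp
  ultimately show ?thesis
    using assms by (simp add: norm_1_def norm_0_squared algebra_simps)
qed

lemma inner_0_add: "inner_0 Mx My v (\<lambda>i j. w i j + z i j) = inner_0 Mx My v w + inner_0 Mx My v z"
  by (simp add: inner_0_def distrib_left sum.distrib)

lemma inner_0_cmult: "inner_0 Mx My v (\<lambda>i j. c * w i j) = c * inner_0 Mx My v w"
  by (simp add: inner_0_def sum_distrib_left mult.left_commute)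

lemma inner_0_sum: "inner_0 Mx My v (\<lambda>i j. \<Sum>l\<in>A. w l i j) = (\<Sum>l\<in>A. inner_0 Mx My v (w l))"
proof -
  have "inner_0 Mx My v (\<lambda>i j. \<Sum>l\<in>A. w l i j)
      = (\<Sum>i=1..Mx-1. \<Sum>l\<in>A. \<Sum>j=1..My-1. v i j * w l i j)"
    unfolding inner_0_def sum_distrib_left by (intro sum.cong refl sum.swap)
  also have "\<dots> = (\<Sum>l\<in>A. inner_0 Mx My v (w l))"
    unfolding inner_0_def by (rule sum.swap)
  finally show ?thesis .
qed

lemma sum_inner_0:
  "(\<Sum>n\<in>A. inner_0 Mx My (v n) (w n)) = (\<Sum>i=1..Mx-1. \<Sum>j=1..My-1. \<Sum>n\<in>A. v n i j * w n i j)"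
  unfolding inner_0_def
  by (subst sum.swap, rule sum.cong, rule refl, rule sum.swap)

lemma summation_by_parts:
  fixes v w :: "nat \<Rightarrow> real"
  assumes "v 0 = 0" "v M = 0"
  shows "(\<Sum>i=1..M-1. v i * (w (i - 1) - 2 * w i + w (i + 1)))
    = - (\<Sum>i=1..M. (v i - v (i - 1)) * (w i - w (i - 1)))"
proof (cases M)
  case (Suc m)
  \<comment> \<open>A boundary term remains at \<open>m\<close>; because \<open>v M = 0\<close>, it
    is the summand \<open>i = M\<close> missing on the right.\<close>
  have "(\<Sum>i=1..m. v i * (w (i - 1) - 2 * w i + w (i + 1)))
      = - (\<Sum>i=1..m. (v i - v (i - 1)) * (w i - w (i - 1))) + v m * (w (Suc m) - w m)"
    by (induction m) (auto simp: algebra_simps assms)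
  then show ?thesis using Suc assms by (simp add: algebra_simps)
qed simp

lemma inner_0_laplace_h:
  assumes v: "v \<in> V_grid Mx My" and M: "Mx \<ge> 1" "My \<ge> 1"
  shows "inner_0 Mx My v (laplace_h hx hy w) = - inner_1 Mx My hx hy v w"
proof -
  have vx: "v 0 j = 0" "v Mx j = 0" if "j \<le> My" for j using v that by (auto simp: V_grid_def)
  have vy: "v i 0 = 0" "v i My = 0" if "i \<le> Mx" for i using v that by (auto simp: V_grid_def)
  have Mx: "{1..Mx} = insert Mx {1..Mx-1}" and My: "{1..My} = insert My {1..My-1}"
    using M by auto
  have "(\<Sum>i=1..Mx-1. v i j * diff2_x hx w i j) = - (\<Sum>i=1..Mx. diff_x hx v i j * diff_x hx w i j)"
    if "j \<le> My" for j
    using summation_by_parts[of "\<lambda>i. v i j" Mx "\<lambda>i. w i j"] vx[OF that]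
    by (simp add: diff2_x_def diff_x_def power2_eq_square flip: sum_divide_distrib)
  then have "(\<Sum>j=1..My-1. \<Sum>i=1..Mx-1. v i j * diff2_x hx w i j)
      = - (\<Sum>j=1..My-1. \<Sum>i=1..Mx. diff_x hx v i j * diff_x hx w i j)"
    by (subst sum_negf[symmetric], intro sum.cong) auto
  \<comment> \<open>\<open>inner_1\<close> also counts the x-differences along the edge
    \<open>j = My\<close>; they vanish because \<open>v\<close> does, so the range of
    \<open>j\<close> extends. The y-differences along \<open>i = Mx\<close> are treated
    alike.\<close>
  also have "(\<Sum>i=1..Mx. diff_x hx v i My * diff_x hx w i My) = 0"
    by (intro sum.neutral) (auto simp: diff_x_def vy)
  then have "(\<Sum>j=1..My-1. \<Sum>i=1..Mx. diff_x hx v i j * diff_x hx w i j)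
      = (\<Sum>j=1..My. \<Sum>i=1..Mx. diff_x hx v i j * diff_x hx w i j)"
    using M by (subst My) simp
  finally have x: "(\<Sum>i=1..Mx-1. \<Sum>j=1..My-1. v i j * diff2_x hx w i j)
      = - (\<Sum>i=1..Mx. \<Sum>j=1..My. diff_x hx v i j * diff_x hx w i j)"
    by (subst (1 2) sum.swap)
  have "(\<Sum>j=1..My-1. v i j * diff2_y hy w i j) = - (\<Sum>j=1..My. diff_y hy v i j * diff_y hy w i j)"
    if "i \<le> Mx" for i
    using summation_by_parts[of "\<lambda>j. v i j" My "\<lambda>j. w i j"] vy[OF that]
    by (simp add: diff2_y_def diff_y_def power2_eq_square flip: sum_divide_distrib)
  then have "(\<Sum>i=1..Mx-1. \<Sum>j=1..My-1. v i j * diff2_y hy w i j)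
      = - (\<Sum>i=1..Mx-1. \<Sum>j=1..My. diff_y hy v i j * diff_y hy w i j)"
    by (subst sum_negf[symmetric], intro sum.cong) auto
  also have "(\<Sum>j=1..My. diff_y hy v Mx j * diff_y hy w Mx j) = 0"
    by (intro sum.neutral) (auto simp: diff_y_def vx)
  then have "(\<Sum>i=1..Mx-1. \<Sum>j=1..My. diff_y hy v i j * diff_y hy w i j)
      = (\<Sum>i=1..Mx. \<Sum>j=1..My. diff_y hy v i j * diff_y hy w i j)"
    using M by (subst Mx) simp
  finally have y: "(\<Sum>i=1..Mx-1. \<Sum>j=1..My-1. v i j * diff2_y hy w i j)
      = - (\<Sum>i=1..Mx. \<Sum>j=1..My. diff_y hy v i j * diff_y hy w i j)" .
  show ?thesis
    unfolding inner_0_def inner_1_def laplace_h_def distrib_left sum.distrib x y by simp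
qed

section \<open>Commutation of time operators with spatial differences\<close>

lemma caputo_01_as_sum:
  "caputo_01 \<alpha> \<tau> U n = (\<lambda>i j. \<Sum>k=1..n.
     (\<tau> powr (1 - \<alpha>) / Gamma (2 - \<alpha>) * c_coeff \<alpha> n (n - k)) * diff_t \<tau> U k i j)"
  by (intro ext) (simp only: caputo_01_def sum_distrib_left mult.assoc)

lemma laplace_h_lincomb:
  "laplace_h hx hy (\<lambda>i j. \<Sum>k\<in>A. c k * w k i j) i j = (\<Sum>k\<in>A. c k * laplace_h hx hy (w k) i j)"
  by (induction A rule: infinite_finite_induct)
    (simp_all add: laplace_h_def diff2_x_def diff2_y_def add_divide_distrib diff_divide_distrib algebra_simps)

lemma diff_x_lincomb:
  "diff_x hx (\<lambda>i j. \<Sum>k\<in>A. c k * w k i j) i j = (\<Sum>k\<in>A. c k * diff_x hx (w k) i j)"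
  by (induction A rule: infinite_finite_induct)
    (simp_all add: diff_x_def add_divide_distrib diff_divide_distrib algebra_simps)

lemma diff_y_lincomb:
  "diff_y hy (\<lambda>i j. \<Sum>k\<in>A. c k * w k i j) i j = (\<Sum>k\<in>A. c k * diff_y hy (w k) i j)"
  by (induction A rule: infinite_finite_induct)
    (simp_all add: diff_y_def add_divide_distrib diff_divide_distrib algebra_simps)

lemma laplace_h_diff_t:
  "laplace_h hx hy (diff_t \<tau> U n) = diff_t \<tau> (\<lambda>k. laplace_h hx hy (U k)) n"
  by (intro ext)
    (simp add: laplace_h_def diff2_x_def diff2_y_def diff_t_def add_divide_distrib diff_divide_distrib mult.commute)

lemma diff_x_diff_t: "diff_x hx (diff_t \<tau> U n) = diff_t \<tau> (\<lambda>k. diff_x hx (U k)) n"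
  by (intro ext) (simp add: diff_x_def diff_t_def diff_divide_distrib mult.commute)

lemma diff_y_diff_t: "diff_y hy (diff_t \<tau> U n) = diff_t \<tau> (\<lambda>k. diff_y hy (U k)) n"
  by (intro ext) (simp add: diff_y_def diff_t_def diff_divide_distrib mult.commute)

lemma diff_x_mid_t: "diff_x hx (mid_t U n) = mid_t (\<lambda>k. diff_x hx (U k)) n"
  by (intro ext) (simp add: diff_x_def mid_t_def add_divide_distrib diff_divide_distrib)

lemma diff_y_mid_t: "diff_y hy (mid_t U n) = mid_t (\<lambda>k. diff_y hy (U k)) n"
  by (intro ext) (simp add: diff_y_def mid_t_def add_divide_distrib diff_divide_distrib)

text \<open>The scheme has the fractional derivative outside the Laplacian; summation by parts in
  space wants the Laplacian outermost.\<close>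

lemma laplace_h_caputo_01:
  "laplace_h hx hy (caputo_01 \<beta> \<tau> U n) = caputo_01 \<beta> \<tau> (\<lambda>k. laplace_h hx hy (U k)) n"
  by (intro ext) (simp only: caputo_01_as_sum laplace_h_lincomb laplace_h_diff_t)

lemma diff_x_caputo_01:
  "diff_x hx (caputo_01 \<beta> \<tau> U n) = caputo_01 \<beta> \<tau> (\<lambda>k. diff_x hx (U k)) n"
  by (intro ext) (simp only: caputo_01_as_sum diff_x_lincomb diff_x_diff_t)

lemma diff_y_caputo_01:
  "diff_y hy (caputo_01 \<beta> \<tau> U n) = caputo_01 \<beta> \<tau> (\<lambda>k. diff_y hy (U k)) n"
  by (intro ext) (simp only: caputo_01_as_sum diff_y_lincomb diff_y_diff_t)

section \<open>Energy bounds for the fractional terms\<close>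

lemma caputo_01_energy_nonneg:
  assumes \<alpha>: "0 < \<alpha>" "\<alpha> < 1"
  shows "0 \<le> (\<Sum>n=1..N. diff_t \<tau> U n i j * caputo_01 \<alpha> \<tau> U n i j)"
proof -
  have "(\<Sum>n=1..N. diff_t \<tau> U n i j * caputo_01 \<alpha> \<tau> U n i j)
     = \<tau> powr (1 - \<alpha>) / Gamma (2 - \<alpha>) *
        (\<Sum>n=1..N. diff_t \<tau> U n i j * (\<Sum>k=1..n. c_coeff \<alpha> n (n - k) * diff_t \<tau> U k i j))"
    unfolding caputo_01_def by (subst sum_distrib_left) (simp only: mult.left_commute)
  moreover have "0 \<le> Gamma (2 - \<alpha>)" using \<alpha> by (intro less_imp_le Gamma_real_pos) auto
  ultimately show ?thesis using c_coeff_form_nonneg[OF \<alpha>]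
    by simp
qed

lemma caputo_01_inner_0_nonneg:
  assumes \<alpha>: "0 < \<alpha>" "\<alpha> < 1"
  shows "0 \<le> (\<Sum>n=1..N. inner_0 Mx My (diff_t \<tau> U n) (caputo_01 \<alpha> \<tau> U n))"
  unfolding sum_inner_0 by (intro sum_nonneg caputo_01_energy_nonneg \<alpha>)

text \<open>Spatial differences commute with both time operators, so the pointwise bound applies to
  the histories of \<open>diff_x hx (U k)\<close> and \<open>diff_y hy (U k)\<close>.\<close>

lemma caputo_01_inner_1_nonneg:
  assumes \<beta>: "0 < \<beta>" "\<beta> < 1"
  shows "0 \<le> (\<Sum>n=1..N. inner_1 Mx My hx hy (diff_t \<tau> U n) (caputo_01 \<beta> \<tau> U n))"
proof -
  have "(\<Sum>n=1..N. inner_1 Mx My hx hy (diff_t \<tau> U n) (caputo_01 \<beta> \<tau> U n))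
      = (\<Sum>i=1..Mx. \<Sum>j=1..My.
          (\<Sum>n=1..N. diff_t \<tau> (\<lambda>k. diff_x hx (U k)) n i j * caputo_01 \<beta> \<tau> (\<lambda>k. diff_x hx (U k)) n i j)
        + (\<Sum>n=1..N. diff_t \<tau> (\<lambda>k. diff_y hy (U k)) n i j * caputo_01 \<beta> \<tau> (\<lambda>k. diff_y hy (U k)) n i j))"
    unfolding inner_1_def diff_x_caputo_01 diff_y_caputo_01 diff_x_diff_t diff_y_diff_t
      sum.distrib[symmetric]
    by (subst sum.swap, rule sum.cong, rule refl, rule sum.swap)
  also have "\<dots> \<ge> 0"
    by (intro sum_nonneg add_nonneg_nonneg caputo_01_energy_nonneg \<beta>)
  finally show ?thesis .
qed

text \<open>This is \<open>L1_form_lower_bound\<close> times \<mu>. With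
  \<open>T = real N * \<tau>\<close>, the uniform weight bound gives the factor of the squared
  velocities through \<open>Gamma (3 - \<gamma>) = (2 - \<gamma>) * Gamma (2 - \<gamma>)\<close>,
  and the sum of the weights gives that of \<open>w\<close>.\<close>

lemma caputo_12_energy:
  assumes \<gamma>: "1 < \<gamma>" "\<gamma> < 2" and \<tau>: "\<tau> > 0" and T: "T = real N * \<tau>" and N: "N \<ge> 1"
  shows "T powr (1 - \<gamma>) / Gamma (2 - \<gamma>) * (\<Sum>n=1..N. (diff_t \<tau> U n i j)\<^sup>2)
      - T powr (2 - \<gamma>) / Gamma (3 - \<gamma>) * (w i j)\<^sup>2 / \<tau>
    \<le> 2 * (\<Sum>n=1..N. diff_t \<tau> U n i j * caputo_12 \<gamma> \<tau> w U n i j)"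
proof -
  define \<mu> where "\<mu> = \<tau> powr (1 - \<gamma>) / Gamma (3 - \<gamma>)"
  let ?v = "\<lambda>n. diff_t \<tau> U n i j"
  have "Gamma (3 - \<gamma>) > 0" using \<gamma> by (intro Gamma_real_pos) auto
  then have \<mu>: "0 < \<mu>" using \<tau> by (simp add: \<mu>_def)
  have "Gamma (3 - \<gamma>) = (2 - \<gamma>) * Gamma (2 - \<gamma>)"
    using Gamma_plus1[of "2 - \<gamma>"] \<gamma> nonpos_Ints_nonpos[of "2 - \<gamma>"] by auto
  then have \<kappa>: "T powr (1 - \<gamma>) / Gamma (2 - \<gamma>) = \<mu> * ((2 - \<gamma>) * real N powr (1 - \<gamma>))"
    using \<gamma> \<tau> by (simp add: T \<mu>_def powr_mult)
  have e: "real N powr (2 - \<gamma>) * \<mu> = T powr (2 - \<gamma>) / Gamma (3 - \<gamma>) / \<tau>"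
    using \<tau> by (simp add: T \<mu>_def powr_mult powr_diff field_simps power2_eq_square)
  have \<omega>: "T powr (2 - \<gamma>) / Gamma (3 - \<gamma>) * (w i j)\<^sup>2 / \<tau> = \<mu> * (real N powr (2 - \<gamma>) * (w i j)\<^sup>2)"
    using arg_cong[OF e, of "\<lambda>x. x * (w i j)\<^sup>2"] by (simp add: mult_ac)
  have "(2 - \<gamma>) * real N powr (1 - \<gamma>) * (\<Sum>n=1..N. (?v n)\<^sup>2)
      \<le> (\<Sum>n=1..N. a_coeff \<gamma> (N - n) * (?v n)\<^sup>2)"
    unfolding sum_distrib_left
    using N by (intro sum_mono mult_right_mono a_coeff_lower_bound \<gamma>) auto
  also have "\<dots> \<le> real N powr (2 - \<gamma>) * (w i j)\<^sup>2 + 2 * (\<Sum>n=1..N. ?v n * (a_coeff \<gamma> 0 * ?v n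
      - (\<Sum>k=1..n-1. (a_coeff \<gamma> (n - k - 1) - a_coeff \<gamma> (n - k)) * ?v k) - a_coeff \<gamma> (n - 1) * w i j))"
    using L1_form_lower_bound[of "a_coeff \<gamma>" N ?v "w i j", OF a_coeff_decreasing[OF \<gamma>] a_coeff_nonneg[OF \<gamma>]]
    unfolding sum_a_coeff[OF \<gamma>] by linarith
  finally have "\<mu> * ((2 - \<gamma>) * real N powr (1 - \<gamma>) * (\<Sum>n=1..N. (?v n)\<^sup>2)) \<le> \<mu> * \<dots>"
    using \<mu> by (intro mult_left_mono) auto
  also have "\<dots> = \<mu> * (real N powr (2 - \<gamma>) * (w i j)\<^sup>2)
      + 2 * (\<Sum>n=1..N. ?v n * caputo_12 \<gamma> \<tau> w U n i j)"
    unfolding caputo_12_def \<mu>_def[symmetric] distrib_left mult.left_commute[of \<mu>] sum_distrib_left[of \<mu>]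
    by simp
  finally show ?thesis unfolding \<kappa> \<omega> by (simp add: mult.assoc)
qed

lemma caputo_12_inner_0:
  assumes \<gamma>: "1 < \<gamma>" "\<gamma> < 2" and \<tau>: "\<tau> > 0" and T: "T = real N * \<tau>" and N: "N \<ge> 1"
  shows "T powr (1 - \<gamma>) / Gamma (2 - \<gamma>) * (\<Sum>n=1..N. inner_0 Mx My (diff_t \<tau> U n) (diff_t \<tau> U n))
      - T powr (2 - \<gamma>) / Gamma (3 - \<gamma>) * inner_0 Mx My w w / \<tau>
    \<le> 2 * (\<Sum>n=1..N. inner_0 Mx My (diff_t \<tau> U n) (caputo_12 \<gamma> \<tau> w U n))"
proof -
  have "(\<Sum>i=1..Mx-1. \<Sum>j=1..My-1. T powr (1 - \<gamma>) / Gamma (2 - \<gamma>) * (\<Sum>n=1..N. (diff_t \<tau> U n i j)\<^sup>2)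
      - T powr (2 - \<gamma>) / Gamma (3 - \<gamma>) * (w i j)\<^sup>2 / \<tau>)
    \<le> (\<Sum>i=1..Mx-1. \<Sum>j=1..My-1. 2 * (\<Sum>n=1..N. diff_t \<tau> U n i j * caputo_12 \<gamma> \<tau> w U n i j))"
    by (intro sum_mono caputo_12_energy assms)
  then show ?thesis
    unfolding sum_inner_0
    by (simp add: inner_0_def sum_subtractf sum_distrib_left sum_divide_distrib power2_eq_square)
qed

section \<open>Telescoping terms and Young's inequality\<close>

text \<open>Velocity times midpoint value is a difference of squares over \<open>2 * \<tau>\<close>,
  which telescopes in time.\<close>

lemma sum_inner_0_mid_t:
  assumes "\<tau> \<noteq> 0"
  shows "(\<Sum>n=1..N. inner_0 Mx My (diff_t \<tau> U n) (mid_t U n))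
    = (inner_0 Mx My (U N) (U N) - inner_0 Mx My (U 0) (U 0)) / (2 * \<tau>)"
proof -
  have *: "inner_0 Mx My (diff_t \<tau> U n) (mid_t U n)
      = (inner_0 Mx My (U n) (U n) - inner_0 Mx My (U (n-1)) (U (n-1))) / (2 * \<tau>)" for n
    unfolding inner_0_def sum_subtractf[symmetric] sum_divide_distrib
    by (intro sum.cong refl) (simp add: diff_t_def mid_t_def assms field_simps)
  show ?thesis
    using sum_telescope''[of 0 N "\<lambda>n. inner_0 Mx My (U n) (U n)"]
    unfolding * sum_divide_distrib[symmetric] by simp
qed

lemma sum_inner_1_mid_t:
  assumes "\<tau> \<noteq> 0"
  shows "(\<Sum>n=1..N. inner_1 Mx My hx hy (diff_t \<tau> U n) (mid_t U n))
    = (inner_1 Mx My hx hy (U N) (U N) - inner_1 Mx My hx hy (U 0) (U 0)) / (2 * \<tau>)"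
proof -
  have *: "inner_1 Mx My hx hy (diff_t \<tau> U n) (mid_t U n)
      = (inner_1 Mx My hx hy (U n) (U n) - inner_1 Mx My hx hy (U (n-1)) (U (n-1))) / (2 * \<tau>)" for n
    unfolding inner_1_def sum_subtractf[symmetric] sum_divide_distrib
      diff_x_diff_t diff_y_diff_t diff_x_mid_t diff_y_mid_t
    by (intro sum.cong refl) (simp add: diff_t_def mid_t_def assms field_simps)
  show ?thesis
    using sum_telescope''[of 0 N "\<lambda>n. inner_1 Mx My hx hy (U n) (U n)"]
    unfolding * sum_divide_distrib[symmetric] by simp
qed

text \<open>Pointwise from the square of \<open>K * x - y\<close> divided by \<open>K\<close>. The
  parameter stays free, to be matched with the total damping.\<close>

lemma inner_0_Young:
  assumes "K > 0"
  shows "2 * inner_0 Mx My v w \<le> K * inner_0 Mx My v v + inner_0 Mx My w w / K"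
proof -
  have "2 * (x * y) \<le> K * (x * x) + y * y / K" for x y :: real
  proof -
    have "0 \<le> (K * x - y)\<^sup>2 / K" using assms by simp
    also have "\<dots> = K * (x * x) + y * y / K - 2 * (x * y)"
      using assms by (simp add: power2_eq_square field_simps)
    finally show ?thesis by simp
  qed
  then show ?thesis
    unfolding inner_0_def sum_distrib_left sum_divide_distrib sum.distrib[symmetric]
    by (intro sum_mono)
qed

section \<open>The energy balance and the stability bound\<close>

theorem theorem5p2:
  fixes p q s :: nat
    and a c d \<gamma> \<alpha> \<beta> :: "nat \<Rightarrow> real"
    and b1 b2 b3 T Lx Ly hx hy \<tau> :: real
    and Mx My N :: nat
    and \<phi>0 \<phi>1 :: "real \<Rightarrow> real \<Rightarrow> real"
    and f :: "real \<Rightarrow> real \<Rightarrow> real \<Rightarrow> real"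
    and U :: "nat \<Rightarrow> nat \<Rightarrow> nat \<Rightarrow> real"
  assumes "p \<ge> 1" and "q \<ge> 1" and "s \<ge> 1"
    and "\<And>l. l \<in> {1..p} \<Longrightarrow> a l > 0"
    and "b1 > 0" and "b2 > 0" and "b3 > 0"
    and "\<And>m. m \<in> {1..q} \<Longrightarrow> c m > 0"
    and "\<And>r. r \<in> {1..s} \<Longrightarrow> d r > 0"
    and "\<And>l. l \<in> {1..p} \<Longrightarrow> 1 < \<gamma> l \<and> \<gamma> l < 2"
    and "\<And>m. m \<in> {1..q} \<Longrightarrow> 0 < \<alpha> m \<and> \<alpha> m < 1"
    and "\<And>r. r \<in> {1..s} \<Longrightarrow> 0 < \<beta> r \<and> \<beta> r < 1"
    and "T > 0" and "Lx > 0" and "Ly > 0"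
    and "Mx \<ge> 2" and "My \<ge> 2" and "N \<ge> 1"
    and "hx = Lx / real Mx" and "hy = Ly / real My" and "\<tau> = T / real N"
    and \<phi>0_boundary: "\<And>x y. (x, y) \<in> frontier ({0<..<Lx} \<times> {0<..<Ly}) \<Longrightarrow> \<phi>0 x y = 0"
    and scheme: "\<And>n i j. n \<in> {1..N} \<Longrightarrow> i \<in> {1..Mx-1} \<Longrightarrow> j \<in> {1..My-1} \<Longrightarrow>
        (\<Sum>l=1..p. a l * caputo_12 (\<gamma> l) \<tau> (sample_xy hx hy \<phi>1) U n i j)
        + b1 * diff_t \<tau> U n i j
        + (\<Sum>m=1..q. c m * caputo_01 (\<alpha> m) \<tau> U n i j)
        + b2 * mid_t U n i j
        = b3 * laplace_h hx hy (mid_t U n) i j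
        + (\<Sum>r=1..s. d r * caputo_01 (\<beta> r) \<tau> (\<lambda>k. laplace_h hx hy (U k)) n i j)
        + mid_t (sample_xyt hx hy \<tau> f) n i j"
    and initial: "\<And>i j. i \<le> Mx \<Longrightarrow> j \<le> My \<Longrightarrow> U 0 i j = sample_xy hx hy \<phi>0 i j"
    and boundary: "\<And>n. n \<in> {1..N} \<Longrightarrow> U n \<in> V_grid Mx My"
  shows "(norm_1 b2 b3 Mx My hx hy (U N))\<^sup>2
      \<le> (norm_1 b2 b3 Mx My hx hy (U 0))\<^sup>2
        + (\<Sum>l=1..p. a l * T powr (2 - \<gamma> l) / Gamma (3 - \<gamma> l))
            * (norm_0 Mx My hx hy (sample_xy hx hy \<phi>1))\<^sup>2
        + T / ((\<Sum>l=1..p. a l * T powr (1 - \<gamma> l) / Gamma (2 - \<gamma> l)) + 2 * b1)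
            * (MAX n\<in>{1..N}. (norm_0 Mx My hx hy (mid_t (sample_xyt hx hy \<tau> f) n))\<^sup>2)"
proof -
  note a_pos = assms(4) and b_pos = assms(5-7) and c_pos = assms(8) and d_pos = assms(9)
    and \<gamma>_range = assms(10) and \<alpha>_range = assms(11) and \<beta>_range = assms(12)
  have M: "Mx \<ge> 1" "My \<ge> 1" and N: "N \<ge> 1" using assms(16-18) by auto
  have h: "hx > 0" "hy > 0" and \<tau>: "\<tau> > 0" and T: "T = real N * \<tau>"
    using assms(13-21) by auto
  \<comment> \<open>At level 0 the zero boundary values come from the initial data: boundary grid
    points lie on the frontier of the domain, where \<open>\<phi>0\<close> vanishes.\<close>
  have U_grid: "U n \<in> V_grid Mx My" if "n \<le> N" for n
  proof (cases n)
    case 0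
    have x_end: "real Mx * hx = Lx" and y_end: "real My * hy = Ly"
      using M assms(19,20) by auto
    have x_range: "real i * hx \<in> {0..Lx}" if "i \<le> Mx" for i
      unfolding x_end[symmetric] using that h by (auto intro: mult_right_mono)
    have y_range: "real j * hy \<in> {0..Ly}" if "j \<le> My" for j
      unfolding y_end[symmetric] using that h by (auto intro: mult_right_mono)
    have frontier: "(x, y) \<in> frontier ({0<..<Lx} \<times> {0<..<Ly})"
      if "x \<in> {0..Lx}" "y \<in> {0..Ly}" "x = 0 \<or> x = Lx \<or> y = 0 \<or> y = Ly" for x y
      using that \<open>Lx > 0\<close> \<open>Ly > 0\<close>
      by (auto simp: frontier_def closure_Times interior_Times)
    have zero: "U 0 i j = 0" if "i \<le> Mx" "j \<le> My" "i = 0 \<or> i = Mx \<or> j = 0 \<or> j = My" for i j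
      using initial[OF that(1,2)] \<phi>0_boundary[OF frontier[OF x_range[OF that(1)] y_range[OF that(2)]]]
        that(3) x_end y_end by (auto simp: sample_xy_def)
    show ?thesis unfolding 0 V_grid_def using zero by auto
  next
    case (Suc m)
    then show ?thesis using boundary[of n] that by auto
  qed
  define V where "V = diff_t \<tau> U"
  have V_grid: "V n \<in> V_grid Mx My" if "n \<in> {1..N}" for n
    using U_grid[of n] U_grid[of "n - 1"] that by (auto simp: V_def V_grid_def diff_t_def)
  define w where "w = sample_xy hx hy \<phi>1"
  define F where "F = mid_t (sample_xyt hx hy \<tau> f)"
  define \<kappa> where "\<kappa> l = T powr (1 - \<gamma> l) / Gamma (2 - \<gamma> l)" for l
  define \<omega> where "\<omega> l = T powr (2 - \<gamma> l) / Gamma (3 - \<gamma> l)" for l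
  define S where "S = (\<Sum>l=1..p. a l * \<kappa> l)"
  define Z where "Z = (\<Sum>n=1..N. inner_0 Mx My (V n) (V n))"
  define W where "W = inner_0 Mx My w w"
  define P where "P l = (\<Sum>n=1..N. inner_0 Mx My (V n) (caputo_12 (\<gamma> l) \<tau> w U n))" for l
  define Q where "Q m = (\<Sum>n=1..N. inner_0 Mx My (V n) (caputo_01 (\<alpha> m) \<tau> U n))" for m
  define R where "R r = (\<Sum>n=1..N. inner_1 Mx My hx hy (V n) (caputo_01 (\<beta> r) \<tau> U n))" for r
  define E0 where "E0 n = inner_0 Mx My (U n) (U n)" for n
  define E1 where "E1 n = inner_1 Mx My hx hy (U n) (U n)" for n
  define G where "G n = inner_0 Mx My (F n) (F n)" for n

  \<comment> \<open>The scheme paired with the velocity \<open>V n\<close>, which vanishes on the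
    boundary, so each Laplacian becomes \<open>- inner_1\<close>.\<close>
  have step: "(\<Sum>l=1..p. a l * inner_0 Mx My (V n) (caputo_12 (\<gamma> l) \<tau> w U n))
      + b1 * inner_0 Mx My (V n) (V n)
      + (\<Sum>m=1..q. c m * inner_0 Mx My (V n) (caputo_01 (\<alpha> m) \<tau> U n))
      + b2 * inner_0 Mx My (V n) (mid_t U n)
      = - b3 * inner_1 Mx My hx hy (V n) (mid_t U n)
        - (\<Sum>r=1..s. d r * inner_1 Mx My hx hy (V n) (caputo_01 (\<beta> r) \<tau> U n))
        + inner_0 Mx My (V n) (F n)" if n: "n \<in> {1..N}" for n
  proof -
    have "inner_0 Mx My (V n) (\<lambda>i j. (\<Sum>l=1..p. a l * caputo_12 (\<gamma> l) \<tau> w U n i j)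
        + b1 * V n i j + (\<Sum>m=1..q. c m * caputo_01 (\<alpha> m) \<tau> U n i j) + b2 * mid_t U n i j)
      = inner_0 Mx My (V n) (\<lambda>i j. b3 * laplace_h hx hy (mid_t U n) i j
        + (\<Sum>r=1..s. d r * laplace_h hx hy (caputo_01 (\<beta> r) \<tau> U n) i j) + F n i j)"
      unfolding inner_0_def laplace_h_caputo_01 w_def V_def F_def
      by (intro sum.cong refl arg_cong2[where f="(*)"] scheme n)
    then show ?thesis
      unfolding inner_0_add inner_0_sum inner_0_cmult inner_0_laplace_h[OF V_grid[OF n] M]
      by (simp add: sum_negf)
  qed
  have sum_swap: "(\<Sum>n=1..N. \<Sum>l\<in>A. g l * x l n) = (\<Sum>l\<in>A. g l * (\<Sum>n=1..N. x l n))"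
    for A :: "nat set" and g :: "nat \<Rightarrow> real" and x
    unfolding sum_distrib_left by (rule sum.swap)
  have "(\<Sum>l=1..p. a l * P l) + b1 * Z + (\<Sum>m=1..q. c m * Q m)
      + b2 * ((E0 N - E0 0) / (2 * \<tau>))
      = - b3 * ((E1 N - E1 0) / (2 * \<tau>)) - (\<Sum>r=1..s. d r * R r)
        + (\<Sum>n=1..N. inner_0 Mx My (V n) (F n))"
  proof -
    have mid0: "(\<Sum>n=1..N. inner_0 Mx My (V n) (mid_t U n)) = (E0 N - E0 0) / (2 * \<tau>)"
      unfolding V_def E0_def using \<tau> by (intro sum_inner_0_mid_t) simp
    have mid1: "(\<Sum>n=1..N. inner_1 Mx My hx hy (V n) (mid_t U n)) = (E1 N - E1 0) / (2 * \<tau>)"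
      unfolding V_def E1_def using \<tau> by (intro sum_inner_1_mid_t) simp
    show ?thesis
      using sum.cong[OF refl step, of "{1..N}" "\<lambda>n. n"]
      unfolding sum.distrib sum_subtractf sum_swap sum_distrib_left[symmetric] mid0 mid1
        P_def Q_def R_def Z_def by simp
  qed
  \<comment> \<open>\<open>S * Z\<close> is the damping gained from the orders in (1,2); the term
    with \<open>W\<close> is the price of the initial velocity.\<close>
  moreover have "S * Z - (\<Sum>l=1..p. a l * \<omega> l) * W / \<tau> \<le> 2 * (\<Sum>l=1..p. a l * P l)"
  proof -
    have "(\<Sum>l=1..p. a l * (\<kappa> l * Z - \<omega> l * W / \<tau>)) \<le> (\<Sum>l=1..p. a l * (2 * P l))"
    proof (intro sum_mono mult_left_mono)
      fix l assume l: "l \<in> {1..p}"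
      show "\<kappa> l * Z - \<omega> l * W / \<tau> \<le> 2 * P l"
        unfolding \<kappa>_def \<omega>_def Z_def W_def P_def V_def
        using \<gamma>_range[OF l] \<tau> T N by (intro caputo_12_inner_0) auto
      show "0 \<le> a l" using a_pos[OF l] by simp
    qed
    then show ?thesis
      by (simp add: S_def sum_distrib_left sum_distrib_right sum_subtractf sum_divide_distrib
          right_diff_distrib mult_ac)
  qed
  moreover have "0 \<le> (\<Sum>m=1..q. c m * Q m)"
    unfolding Q_def V_def using c_pos \<alpha>_range
    by (intro sum_nonneg mult_nonneg_nonneg caputo_01_inner_0_nonneg) (auto simp: less_imp_le)
  moreover have "0 \<le> (\<Sum>r=1..s. d r * R r)"
    unfolding R_def V_def using d_pos \<beta>_range
    by (intro sum_nonneg mult_nonneg_nonneg caputo_01_inner_1_nonneg) (auto simp: less_imp_le)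
  moreover have S: "0 \<le> S"
    unfolding S_def \<kappa>_def using a_pos \<gamma>_range
    by (intro sum_nonneg mult_nonneg_nonneg divide_nonneg_nonneg less_imp_le[OF Gamma_real_pos])
      (auto simp: less_imp_le)
  then have K: "0 < S + 2 * b1" using b_pos by simp
  \<comment> \<open>With \<open>K = S + 2 * b1\<close> the squared velocities are absorbed exactly
    by \<open>S * Z\<close> and the \<open>b1\<close> term of the doubled balance. This fixes the
    denominator of the final bound.\<close>
  have "2 * (\<Sum>n=1..N. inner_0 Mx My (V n) (F n)) \<le> (S + 2 * b1) * Z + (\<Sum>n=1..N. G n) / (S + 2 * b1)"
    unfolding Z_def G_def sum_distrib_left sum_divide_distrib sum.distrib[symmetric]
    by (intro sum_mono inner_0_Young K)
  then have "2 * (\<Sum>n=1..N. inner_0 Mx My (V n) (F n)) \<le> S * Z + 2 * (b1 * Z) + (\<Sum>n=1..N. G n) / (S + 2 * b1)"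
    by (simp add: distrib_right)
  \<comment> \<open>The balance is doubled and the nonnegative sums with \<open>Q\<close> and
    \<open>R\<close> are dropped.\<close>
  ultimately have bound: "2 * (b2 * ((E0 N - E0 0) / (2 * \<tau>))) + 2 * (b3 * ((E1 N - E1 0) / (2 * \<tau>)))
      \<le> (\<Sum>l=1..p. a l * \<omega> l) * W / \<tau> + (\<Sum>n=1..N. G n) / (S + 2 * b1)"
    by linarith
  have cancel: "\<tau> * (2 * (b * (x / (2 * \<tau>)))) = b * x" for b x
    using \<tau> by simp
  from bound have "\<tau> * (2 * (b2 * ((E0 N - E0 0) / (2 * \<tau>))) + 2 * (b3 * ((E1 N - E1 0) / (2 * \<tau>))))
      \<le> \<tau> * ((\<Sum>l=1..p. a l * \<omega> l) * W / \<tau> + (\<Sum>n=1..N. G n) / (S + 2 * b1))"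
    using \<tau> by (intro mult_left_mono) auto
  then have energy: "b2 * E0 N + b3 * E1 N
      \<le> b2 * E0 0 + b3 * E1 0 + (\<Sum>l=1..p. a l * \<omega> l) * W + \<tau> / (S + 2 * b1) * (\<Sum>n=1..N. G n)"
    using \<tau> unfolding distrib_left cancel by (simp add: right_diff_distrib)

  \<comment> \<open>Each of the \<open>N\<close> levels is bounded by the maximum, and
    \<open>\<tau> * real N = T\<close> gives the factor of the source.\<close>
  define m where "m = (MAX n\<in>{1..N}. (norm_0 Mx My hx hy (F n))\<^sup>2)"
  have "hx * hy * (\<Sum>n=1..N. G n) = (\<Sum>n=1..N. (norm_0 Mx My hx hy (F n))\<^sup>2)"
    by (simp add: norm_0_squared[OF h] G_def sum_distrib_left)
  also have "\<dots> \<le> real (card {1..N}) * m"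
    unfolding m_def by (intro sum_bounded_above Max_ge) auto
  finally have "\<tau> / (S + 2 * b1) * (hx * hy * (\<Sum>n=1..N. G n)) \<le> \<tau> / (S + 2 * b1) * (real N * m)"
    using \<tau> K by (intro mult_left_mono) auto
  also have "\<dots> = T / (S + 2 * b1) * m" by (simp add: T)
  finally have max: "hx * hy * (\<tau> / (S + 2 * b1) * (\<Sum>n=1..N. G n)) \<le> T / (S + 2 * b1) * m"
    by (simp add: mult_ac)
  have "(norm_1 b2 b3 Mx My hx hy (U N))\<^sup>2 = hx * hy * (b2 * E0 N + b3 * E1 N)"
    using h b_pos by (simp add: norm_1_squared E0_def E1_def)
  also have "\<dots> \<le> hx * hy * (b2 * E0 0 + b3 * E1 0 + (\<Sum>l=1..p. a l * \<omega> l) * W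
      + \<tau> / (S + 2 * b1) * (\<Sum>n=1..N. G n))"
    using h by (intro mult_left_mono energy) auto
  also have "\<dots> = (norm_1 b2 b3 Mx My hx hy (U 0))\<^sup>2
      + (\<Sum>l=1..p. a l * \<omega> l) * (norm_0 Mx My hx hy w)\<^sup>2
      + hx * hy * (\<tau> / (S + 2 * b1) * (\<Sum>n=1..N. G n))"
    using h b_pos by (simp add: norm_1_squared norm_0_squared E0_def E1_def W_def algebra_simps)
  also have "\<dots> \<le> (norm_1 b2 b3 Mx My hx hy (U 0))\<^sup>2
      + (\<Sum>l=1..p. a l * \<omega> l) * (norm_0 Mx My hx hy w)\<^sup>2 + T / (S + 2 * b1) * m"
    using max by simp
  finally show ?thesis
    unfolding S_def \<kappa>_def \<omega>_def m_def F_def w_def by simp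
qed

end
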